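(* For all integers $n \geq 2$ it holds $$ \sum_{m=1}^{F_n-1} \frac1{\sin(\pi m/F_n)^2} \cdot \frac1{\sin(\pi F_{n-1}m/F_n)^2} = \frac{4n}{75} F_{2n} - \frac{17}{1125}L_{2n} - (-1)^n \frac{116}{1125} - \frac19. $$
   Context: $(F_n)_n$ are the Fibonacci numbers $F_0=0$, $F_1=1$, $F_n=F_{n-1}+F_{n-2}$, and $(L_n)_n$ are the Lucas numbers $L_0=2$, $L_1=1$, $L_n=L_{n-1}+L_{n-2}$. An empty sum equals $0$. *)

theory Defs
  imports "HOL-Analysis.Analysis" "HOL-Number_Theory.Fib"
begin

fun lucas :: "nat \<Rightarrow> nat" where
  "lucas 0 = 2"
| "lucas (Suc 0) = 1"
| "lucas (Suc (Suc n)) = lucas (Suc n) + lucas n"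

end

theory Submission
  imports Defs
begin

text \<open>Put \<open>N = F\<^bsub>n\<^esub>\<close> and \<open>h = F\<^bsub>n-1\<^esub>\<close>. The discrete Fourier transform of \<open>k * (N - k)\<close> modulo \<open>N\<close> is
\<open>-N / (2 * sin (pi * m / N)^2)\<close> at every frequency \<open>m\<close> other than \<open>0\<close>. By Parseval's identity the
trigonometric sum is therefore an elementary function of \<open>N\<close> plus \<open>4 / N\<close> times the sum of
\<open>l * (N - l) * r * (N - r)\<close> over \<open>0 \<le> l < N\<close>, where \<open>r\<close> is the remainder of \<open>h * l\<close> modulo \<open>N\<close>
(\<open>sum_reciprocal_sine_squares\<close>). This is a Dedekind sum of higher order.

Writing \<open>r\<close> through the quotient of \<open>h * l\<close> by \<open>N\<close> turns that sum into a cubic polynomial summed over the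
lattice points of the triangle under the line of slope \<open>h / N\<close> (\<open>sum_remainder_products\<close>). Lattice
points in such triangles obey a Euclidean algorithm: reflecting in the diagonal of a rectangle
exchanges the two sides (\<open>triangle_sum_swap\<close>), and a shear lowers the slope by one
(\<open>triangle_sum_shear\<close>). For consecutive Fibonacci numbers every quotient of the algorithm is 1, so
one swap and one shear carry the triangle of index \<open>n + 1\<close> to that of index \<open>n\<close>, while the polynomial
undergoes the fixed substitution \<open>(x, y) \<mapsto> (x + y, x)\<close> (\<open>triangle_sum_fib_Suc\<close>).

The substitution preserves degrees, and only monomials of degree 2 and 3 occur. Their moments thus
satisfy finite linear recursions with constant coefficients, whose inhomogeneous terms are polynomials
in \<open>F\<^bsub>n\<^esub>\<close> and \<open>F\<^bsub>n+1\<^esub>\<close>. The solutions (\<open>fib_moment_closed_form\<close>) are polynomials in \<open>F\<^bsub>n\<^esub>\<close>, \<open>F\<^bsub>n+1\<^esub>\<close>,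
\<open>(- 1) ^ n\<close> and \<open>n\<close>; they are verified by induction, and inserting them gives the result. All the polynomial
identities hold modulo the relation \<open>(F\<^bsub>n+1\<^esub>^2 - F\<^bsub>n+1\<^esub> * F\<^bsub>n\<^esub> - F\<^bsub>n\<^esub>^2)^2 = 1\<close>.\<close>

section \<open>Reciprocal squared sines as Fourier coefficients\<close>

text \<open>The sequence \<open>k * (N - k)\<close> is a parabola vanishing at both ends of a period, so as a function on
the integers modulo \<open>N\<close> it has the constant second difference \<open>-2\<close> except for a spike at the origin.
Hence multiplying its Fourier transform by \<open>(z - 1)^2 / z\<close> leaves only the contribution \<open>2 * N\<close>
of the spike.\<close>
lemma sum_quadratic_times_power:
  fixes z :: "'a :: field"
  assumes "z ^ N = 1" "z \<noteq> 1"
  shows "(\<Sum>k<N. of_nat k * (of_nat N - of_nat k) * z ^ k) * (z - 1)^2 = 2 * of_nat N * z"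
proof -
  \<comment> \<open>The summand, times \<open>(z - 1)^3\<close>, is a difference of consecutive values of \<open>P c n * z ^ n\<close>;
    the coefficients of the quadratic \<open>P c\<close> are forced by \<open>P c (n + 1) * z - P c n = n * (c - n) * (z - 1)^3\<close>.\<close>
  define P where "P c x = (c * (z - 1)^2 + 2 * z * (z - 1)) * x - (z - 1)^2 * x^2
      - z * (z + 1 + c * (z - 1))" for c x
  have "(\<Sum>k<n. of_nat k * (c - of_nat k) * z ^ k) * (z - 1)^3 = P c (of_nat n) * z ^ n - P c 0"
    for c :: 'a and n
  proof (induction n)
    case (Suc n)
    have step: "of_nat n * (c - of_nat n) * (z - 1)^3 = P c (of_nat n + 1) * z - P c (of_nat n)"
      unfolding P_def by (simp add: algebra_simps power2_eq_square power3_eq_cube)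
    have "(\<Sum>k<Suc n. of_nat k * (c - of_nat k) * z ^ k) * (z - 1)^3
        = P c (of_nat n) * z ^ n - P c 0 + of_nat n * (c - of_nat n) * (z - 1)^3 * z ^ n"
      unfolding Suc.IH[symmetric] by (simp add: algebra_simps)
    also have "\<dots> = P c (of_nat (Suc n)) * z ^ Suc n - P c 0"
      unfolding step by (simp add: algebra_simps)
    finally show ?case .
  qed simp
  from this[of "of_nat N" N] have
    "(\<Sum>k<N. of_nat k * (of_nat N - of_nat k) * z ^ k) * (z - 1)^2 * (z - 1) = 2 * of_nat N * z * (z - 1)"
    using assms(1) by (simp add: P_def algebra_simps power2_eq_square power3_eq_cube)
  thus ?thesis using assms(2) by simp
qed

lemma cis_double_minus_one_squared: "(cis (2 * t) - 1)^2 = - of_real (4 * (sin t)^2) * cis (2 * t)"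
proof -
  have "cis (2 * t) - 1 = 2 * \<i> * of_real (sin t) * cis t"
    by (simp add: complex_eq_iff cos_double_sin sin_double power2_eq_square)
  moreover have "(cis t)^2 = cis (2 * t)" using Complex.DeMoivre[of t 2] by simp
  ultimately show ?thesis by (simp add: power_mult_distrib)
qed

lemma sin_pi_quotient_eq_0_iff:
  assumes "N > 0"
  shows "sin (pi * real j / real N) = 0 \<longleftrightarrow> N dvd j"
proof -
  have "pi * real j / real N = of_int i * pi \<longleftrightarrow> int j = i * int N" for i
  proof -
    have "pi * real j / real N = of_int i * pi \<longleftrightarrow> real j = of_int i * real N"
      using assms by (simp add: field_simps)
    also have "\<dots> \<longleftrightarrow> int j = i * int N"
      by (metis of_int_eq_iff of_int_mult of_int_of_nat_eq)
    finally show ?thesis .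
  qed
  hence "sin (pi * real j / real N) = 0 \<longleftrightarrow> int N dvd int j"
    by (simp add: sin_zero_iff_int2 dvd_def mult.commute)
  thus ?thesis by simp
qed

definition root_of_unity :: "nat \<Rightarrow> nat \<Rightarrow> complex" where
  "root_of_unity N j = cis (2 * (pi * real j / real N))"

lemma root_of_unity_add: "root_of_unity N (i + j) = root_of_unity N i * root_of_unity N j"
  by (simp add: root_of_unity_def cis_mult distrib_left add_divide_distrib)

lemma root_of_unity_power: "root_of_unity N j ^ k = root_of_unity N (j * k)"
  unfolding root_of_unity_def Complex.DeMoivre by (rule arg_cong[where f = cis]) simp

lemma root_of_unity_eq_1_iff:
  assumes "N > 0"
  shows "root_of_unity N j = 1 \<longleftrightarrow> N dvd j"
proof -
  have "root_of_unity N j = 1 \<longleftrightarrow> sin (pi * real j / real N) = 0"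
    using cis_double_minus_one_squared[of "pi * real j / real N"]
    by (auto simp: root_of_unity_def)
  thus ?thesis using sin_pi_quotient_eq_0_iff[OF assms] by simp
qed

lemma sum_root_of_unity:
  assumes "N > 0"
  shows "(\<Sum>m<N. root_of_unity N (j * m)) = (if N dvd j then of_nat N else 0)"
proof -
  have "root_of_unity N j ^ N = 1"
    by (simp add: root_of_unity_power root_of_unity_eq_1_iff assms)
  thus ?thesis
    using geometric_sum[of "root_of_unity N j" N] root_of_unity_eq_1_iff[OF assms, of j]
    by (auto simp flip: root_of_unity_power)
qed

text \<open>Reciprocal squared sines are Fourier coefficients of a polynomial; this is what makes the
trigonometric sum rational.\<close>
lemma fourier_quadratic:
  assumes "N > 0" "\<not> N dvd j"
  shows "(\<Sum>k<N. of_real (real k * (real N - real k)) * root_of_unity N (j * k))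
    = of_real (- real N / (2 * (sin (pi * real j / real N))^2))"
proof -
  define S where "S = (\<Sum>k<N. of_real (real k * (real N - real k)) * root_of_unity N (j * k))"
  define s where "s = sin (pi * real j / real N)"
  have z: "root_of_unity N j ^ N = 1" "root_of_unity N j \<noteq> 1"
    using assms by (simp_all add: root_of_unity_power root_of_unity_eq_1_iff)
  have "s \<noteq> 0" using sin_pi_quotient_eq_0_iff assms by (simp add: s_def)
  have "root_of_unity N j \<noteq> 0" by (simp add: root_of_unity_def)
  moreover have "S * (root_of_unity N j - 1)^2 = 2 * of_nat N * root_of_unity N j"
    using sum_quadratic_times_power[OF z] by (simp add: S_def root_of_unity_power)
  hence "S * (- of_real (4 * s^2)) * root_of_unity N j = 2 * of_nat N * root_of_unity N j"
    unfolding root_of_unity_def cis_double_minus_one_squared s_def by (simp only: mult.assoc)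
  ultimately have "S * (- of_real (4 * s^2)) = 2 * of_nat N" by (simp only: mult_right_cancel simp_thms)
  moreover have "- of_real (4 * s^2) \<noteq> (0 :: complex)" using \<open>s \<noteq> 0\<close> by simp
  ultimately have "S = 2 * of_nat N / - of_real (4 * s^2)" by (metis nonzero_eq_divide_eq)
  also have "\<dots> = of_real (2 * real N / - (4 * s^2))"
    by (simp only: of_real_divide of_real_minus of_real_mult of_real_of_nat_eq of_real_numeral)
  also have "2 * real N / - (4 * s^2) = - real N / (2 * s^2)" by simp
  finally have "S = of_real (- real N / (2 * s^2))" .
  thus ?thesis by (simp add: S_def s_def)
qed

text \<open>This is Parseval's identity for the transform \<open>G\<close> of \<open>g k = k * (N - k)\<close>: the sum of
\<open>G m * G (h * m)\<close> over all residues \<open>m\<close> is \<open>N\<close> times the correlation of \<open>g l\<close> with \<open>g (h * l)\<close>.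
The frequency \<open>m = 0\<close>, at which \<open>G\<close> is not a reciprocal sine, is responsible for the subtracted term.\<close>
lemma sum_reciprocal_sine_squares:
  assumes "coprime h N" "N > 0"
  shows "(\<Sum>m = 1..<N. 1 / (sin (pi * real m / real N))^2
            * (1 / (sin (pi * real h * real m / real N))^2))
    = 4 / real N * (\<Sum>l<N. real l * (real N - real l)
          * (real (h * l mod N) * (real N - real (h * l mod N))))
      - ((real N)^2 - 1)^2 / 9"
proof -
  define g where "g k = real k * (real N - real k)" for k
  define G where "G j = (\<Sum>k<N. of_real (g k) * root_of_unity N (j * k))" for j
  define Q where "Q = (\<Sum>l<N. g l * g (h * l mod N))"
  define S where "S = (\<Sum>m = 1..<N. 1 / (sin (pi * real m / real N))^2
            * (1 / (sin (pi * real h * real m / real N))^2))"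
  \<comment> \<open>Orthogonality leaves the single index \<open>k\<close> congruent to \<open>-r\<close>, and \<open>g\<close> is even modulo \<open>N\<close>.\<close>
  have pick: "(\<Sum>k<N. g k * (if N dvd k + r then real N else 0)) = real N * g r" if "r < N" for r
  proof -
    define k0 where "k0 = (if r = 0 then 0 else N - r)"
    have "N dvd k + r \<longleftrightarrow> k = k0" if "k < N" for k
    proof
      assume "N dvd k + r"
      moreover have "k + r < 2 * N" using that \<open>r < N\<close> by simp
      ultimately obtain q where q: "k + r = N * q" "N * q < N * 2" by (metis dvdE mult.commute)
      hence "q = 0 \<or> q = 1" by auto
      thus "k = k0" using q(1) that \<open>r < N\<close> by (auto simp: k0_def)
    qed (use \<open>r < N\<close> in \<open>auto simp: k0_def\<close>)
    hence "(\<Sum>k<N. g k * (if N dvd k + r then real N else 0)) = (\<Sum>k<N. if k = k0 then g k * real N else 0)"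
      by (intro sum.cong) auto
    also have "\<dots> = g k0 * real N" using \<open>r < N\<close> by (simp add: k0_def)
    also have "g k0 = g r" using \<open>r < N\<close> by (simp add: k0_def g_def of_nat_diff)
    finally show ?thesis by simp
  qed
  have "(\<Sum>m<N. G m * G (h * m))
      = (\<Sum>m<N. \<Sum>l<N. \<Sum>k<N. of_real (g l * g k) * root_of_unity N ((k + h * l) * m))"
    unfolding G_def sum_product
    by (intro sum.cong refl trans[OF sum.swap]) (simp add: root_of_unity_add algebra_simps)
  also have "\<dots> = (\<Sum>l<N. \<Sum>k<N. \<Sum>m<N. of_real (g l * g k) * root_of_unity N ((k + h * l) * m))"
    by (rule trans[OF sum.swap]) (intro sum.cong refl sum.swap)
  also have "\<dots> = (\<Sum>l<N. \<Sum>k<N. of_real (g l * g k * (if N dvd k + h * l mod N then real N else 0)))"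
    using assms(2) by (intro sum.cong refl)
      (auto simp: sum_distrib_left[symmetric] sum_root_of_unity mod_add_right_eq dvd_eq_mod_eq_0)
  also have "\<dots> = of_real (\<Sum>l<N. g l * (\<Sum>k<N. g k * (if N dvd k + h * l mod N then real N else 0)))"
    by (simp add: sum_distrib_left mult_ac)
  also have "\<dots> = of_real (real N * Q)"
    using assms(2) by (simp add: pick Q_def sum_distrib_left mult_ac)
  finally have parseval: "(\<Sum>m<N. G m * G (h * m)) = of_real (real N * Q)" .

  have "(\<Sum>k<n. real k * (c - real k)) = real n * (real n - 1) * (3 * c - 2 * real n + 1) / 6" for c n
    by (induction n) (simp_all add: field_simps)
  from this[of "real N" N] have "(\<Sum>k<N. g k) = real N * ((real N)^2 - 1) / 6"
    by (simp add: g_def power2_eq_square algebra_simps)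
  moreover have "G 0 = of_real (\<Sum>k<N. g k)" by (simp add: G_def root_of_unity_def)
  ultimately have G0: "G 0 = of_real (real N * ((real N)^2 - 1) / 6)" by (simp only:)
  have "{..<N} = insert 0 {1..<N}" using assms(2) by auto
  hence "(\<Sum>m<N. G m * G (h * m)) = G 0 * G 0 + (\<Sum>m = 1..<N. G m * G (h * m))" by simp
  also have "(\<Sum>m = 1..<N. G m * G (h * m)) = (\<Sum>m = 1..<N. of_real ((real N)^2 / 4
       * (1 / (sin (pi * real m / real N))^2 * (1 / (sin (pi * real h * real m / real N))^2))))"
  proof (rule sum.cong[OF refl])
    fix m assume m: "m \<in> {1..<N}"
    hence "\<not> N dvd m" by (auto dest: nat_dvd_not_less)
    moreover from this have "\<not> N dvd h * m"
      using assms by (simp add: coprime_dvd_mult_right_iff coprime_commute)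
    ultimately have "G m * G (h * m) = of_real (- real N / (2 * (sin (pi * real m / real N))^2)
        * (- real N / (2 * (sin (pi * real (h * m) / real N))^2)))"
      unfolding G_def g_def of_real_mult[of "_ / _"] by (simp only: fourier_quadratic assms(2) simp_thms)
    thus "G m * G (h * m) = of_real ((real N)^2 / 4
       * (1 / (sin (pi * real m / real N))^2 * (1 / (sin (pi * real h * real m / real N))^2)))"
      by (simp add: power2_eq_square mult.assoc)
  qed
  finally have "of_real (real N * Q) = (of_real ((real N * ((real N)^2 - 1) / 6)^2
      + (real N)^2 / 4 * S) :: complex)"
    by (simp add: parseval G0 power2_eq_square sum_distrib_left S_def)
  hence "real N * Q = (real N * ((real N)^2 - 1) / 6)^2 + (real N)^2 / 4 * S"
    by (simp only: of_real_eq_iff)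
  moreover have "s = 4 / x * q - (x^2 - 1)^2 / 9"
    if "x * q = (x * (x^2 - 1) / 6)^2 + x^2 / 4 * s" "x > 0" for x q s :: real
  proof -
    have "x * q = x^2 * ((x^2 - 1)^2 / 36 + s / 4)"
      using that(1) by (simp add: power_mult_distrib power_divide distrib_left)
    hence "q = x * ((x^2 - 1)^2 / 36 + s / 4)" using that(2) by (simp add: power2_eq_square)
    thus ?thesis using that(2) by (simp add: field_simps)
  qed
  ultimately have "S = 4 / real N * Q - ((real N)^2 - 1)^2 / 9" using assms(2) by simp
  thus ?thesis by (simp add: Q_def g_def S_def)
qed

section \<open>Lattice points in triangles\<close>

text \<open>For coprime \<open>N\<close> and \<open>M\<close> the range consists of the lattice points strictly inside the triangle with
vertices \<open>(0, 0)\<close>, \<open>(N, 0)\<close>, \<open>(N, M)\<close>: no lattice point with \<open>0 < x < N\<close> lies on the slanted side.\<close>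
definition triangle_sum :: "nat \<Rightarrow> nat \<Rightarrow> (nat \<Rightarrow> nat \<Rightarrow> real) \<Rightarrow> real" where
  "triangle_sum N M p = (\<Sum>x = 1..<N. \<Sum>y = 1..M * x div N. p x y)"

text \<open>Reciprocity: the diagonal from \<open>(0, 0)\<close> to \<open>(N, M)\<close> meets no interior lattice point of the
rectangle, so it cuts the interior points into those below it and those above it.\<close>
lemma triangle_sum_swap:
  assumes "coprime M N"
  shows "triangle_sum N M p + triangle_sum M N (\<lambda>x y. p y x) = (\<Sum>x = 1..<N. \<Sum>y = 1..<M. p x y)"
proof -
  \<comment> \<open>Below the diagonal the bound \<open>y < b\<close> is automatic, and \<open>y \<le> b * x div a\<close> is a strict
    inequality; stated for generic sides because it is needed in both orientations.\<close>
  have range_iff: "y \<in> {1..b * x div a} \<longleftrightarrow> y \<in> {1..<b} \<and> a * y < b * x"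
    if "coprime a b" "x \<in> {1..<a}" for a b x y :: nat
  proof -
    have "\<not> a dvd b * x"
      using that coprime_dvd_mult_right_iff[of a b x] by (auto dest: nat_dvd_not_less)
    hence "a * y \<noteq> b * x" by (metis dvd_triv_left)
    hence strict: "a * y \<le> b * x \<longleftrightarrow> a * y < b * x" by (simp only: le_less simp_thms)
    have "y \<le> b * x div a \<longleftrightarrow> a * y \<le> b * x"
      using that by (simp add: less_eq_div_iff_mult_less_eq mult.commute)
    moreover have "y < b" if "a * y < b * x"
    proof -
      have "b * x \<le> b * a" using \<open>x \<in> {1..<a}\<close> by simp
      with that have "a * y < b * a" by (rule less_le_trans)
      thus ?thesis by (simp add: mult.commute)
    qed
    ultimately show ?thesis
      unfolding strict atLeastAtMost_iff atLeastLessThan_iff by blast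
  qed
  have coprime_NM: "coprime N M" using assms by (simp add: coprime_commute)
  have lower: "triangle_sum N M p = (\<Sum>x = 1..<N. \<Sum>y = 1..<M. if N * y < M * x then p x y else 0)"
    unfolding triangle_sum_def
  proof (rule sum.cong[OF refl])
    fix x assume x: "x \<in> {1..<N}"
    have "{1..M * x div N} = {1..<M} \<inter> {y. N * y < M * x}"
      using range_iff[OF coprime_NM x] by blast
    thus "(\<Sum>y = 1..M * x div N. p x y) = (\<Sum>y = 1..<M. if N * y < M * x then p x y else 0)"
      by (simp add: sum.inter_restrict)
  qed
  have "triangle_sum M N (\<lambda>x y. p y x)
      = (\<Sum>y = 1..<M. \<Sum>x = 1..<N. if M * x < N * y then p x y else 0)"
    unfolding triangle_sum_def
  proof (rule sum.cong[OF refl])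
    fix y assume y: "y \<in> {1..<M}"
    have "{1..N * y div M} = {1..<N} \<inter> {x. M * x < N * y}"
      using range_iff[OF assms y] by blast
    thus "(\<Sum>x = 1..N * y div M. p x y) = (\<Sum>x = 1..<N. if M * x < N * y then p x y else 0)"
      by (simp add: sum.inter_restrict)
  qed
  also have "\<dots> = (\<Sum>x = 1..<N. \<Sum>y = 1..<M. if M * x < N * y then p x y else 0)"
    by (rule sum.swap)
  finally have upper: "triangle_sum M N (\<lambda>x y. p y x) = \<dots>" .
  have "N * y < M * x \<or> M * x < N * y" if "x \<in> {1..<N}" for x y
  proof -
    have "\<not> N dvd M * x"
      using that coprime_dvd_mult_right_iff[OF coprime_NM, of x] by (auto dest: nat_dvd_not_less)
    thus ?thesis by (metis dvd_triv_left linorder_neqE_nat)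
  qed
  thus ?thesis
    unfolding lower upper sum.distrib[symmetric] by (intro sum.cong refl) force
qed

text \<open>The shear \<open>(x, y) \<mapsto> (x, x + y)\<close> maps the triangle of slope \<open>M / N\<close> onto the part above the line
\<open>y = x\<close> of the triangle of slope \<open>(M + N) / N\<close>; what remains is a staircase.\<close>
lemma triangle_sum_shear:
  assumes "N > 0"
  shows "triangle_sum N (M + N) p
    = triangle_sum N M (\<lambda>x y. p x (x + y)) + (\<Sum>x = 1..<N. \<Sum>y = 1..x. p x y)"
proof -
  have "(\<Sum>y = 1..(M + N) * x div N. p x y)
      = (\<Sum>y = 1..M * x div N. p x (x + y)) + (\<Sum>y = 1..x. p x y)" for x
  proof -
    have "(M + N) * x div N = x + M * x div N"
      using assms by (simp add: distrib_right add.commute)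
    moreover have "{1..x + k} = {1..x} \<union> {1 + x..k + x}" for k by auto
    moreover have "(\<Sum>y = 1 + x..k + x. p x y) = (\<Sum>y = 1..k. p x (x + y))" for k
      by (subst sum.shift_bounds_cl_nat_ivl) (simp add: add.commute)
    ultimately show ?thesis by (simp add: sum.union_disjoint)
  qed
  thus ?thesis by (simp add: triangle_sum_def sum.distrib)
qed

definition power_sum :: "nat \<Rightarrow> nat \<Rightarrow> real" where
  "power_sum k N = (\<Sum>x = 1..<N. real x ^ k)"

lemma power_sum_closed_form:
  assumes "N \<ge> 1"
  shows "power_sum 0 N = real N - 1"
    and "power_sum 1 N = real N * (real N - 1) / 2"
    and "power_sum 2 N = real N * (real N - 1) * (2 * real N - 1) / 6"
    and "power_sum 3 N = (real N * (real N - 1) / 2)^2"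
    and "power_sum 4 N = real N * (real N - 1) * (2 * real N - 1) * (3 * real N^2 - 3 * real N - 1) / 30"
proof -
  obtain K where N: "N = Suc K" using assms by (cases N) auto
  show "power_sum 0 N = real N - 1"
    and "power_sum 1 N = real N * (real N - 1) / 2"
    and "power_sum 2 N = real N * (real N - 1) * (2 * real N - 1) / 6"
    and "power_sum 3 N = (real N * (real N - 1) / 2)^2"
    and "power_sum 4 N = real N * (real N - 1) * (2 * real N - 1) * (3 * real N^2 - 3 * real N - 1) / 30"
    unfolding N by (induction K; simp add: power_sum_def field_simps power2_eq_square power3_eq_cube power4_eq_xxxx)+
qed

text \<open>With \<open>r = h * x - N * Y\<close> and \<open>Y = h * x div N\<close>, the product \<open>r * (N - r)\<close> is quadratic in \<open>Y\<close> and
therefore equals its value for \<open>Y = 0\<close> plus a sum of \<open>Y\<close> terms linear in \<open>y\<close>. This trades the remainders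
for a polynomial summed over lattice points.\<close>
lemma sum_remainder_products:
  assumes "N > 0"
  shows "(\<Sum>l<N. real l * (real N - real l) * (real (h * l mod N) * (real N - real (h * l mod N))))
    = real h * (real N ^ 2 * power_sum 2 N - real N * (1 + real h) * power_sum 3 N
        + real h * power_sum 4 N)
      + 2 * real N * triangle_sum N h
          (\<lambda>x y. real x * (real N - real x) * (real h * real x - real N * real y))"
proof -
  have column: "real (h * x mod N) * (real N - real (h * x mod N))
      = real h * real x * (real N - real h * real x)
        + 2 * real N * (\<Sum>y = 1..h * x div N. real h * real x - real N * real y)" for x
  proof -
    define Y where "Y = h * x div N"
    have column_sum: "(\<Sum>y = 1..k. c - real N * real y) = real k * c - real N * real k * (real k + 1) / 2" for c k
      by (induction k) (simp_all add: field_simps)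
    have remainder: "real (h * x mod N) = real h * real x - real N * real Y"
      unfolding Y_def using mult_div_mod_eq[of N "h * x"]
      by (metis add_diff_cancel_left' of_nat_add of_nat_mult)
    show ?thesis
      unfolding Y_def[symmetric] column_sum remainder by (simp add: field_simps)
  qed
  have "{..<N} = insert 0 {1..<N}" using assms by auto
  hence "(\<Sum>l<N. real l * (real N - real l) * (real (h * l mod N) * (real N - real (h * l mod N))))
      = (\<Sum>x = 1..<N. real x * (real N - real x) * (real (h * x mod N) * (real N - real (h * x mod N))))"
    by simp
  also have "\<dots> = (\<Sum>x = 1..<N. real h * (real N ^ 2 * real x ^ 2 - real N * (1 + real h) * real x ^ 3
          + real h * real x ^ 4)
        + 2 * real N * (\<Sum>y = 1..h * x div N.
            real x * (real N - real x) * (real h * real x - real N * real y)))"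
    unfolding column
    by (intro sum.cong refl)
       (simp only: sum_distrib_left[symmetric], simp add: algebra_simps eval_nat_numeral)
  finally show ?thesis
    by (simp add: power_sum_def triangle_sum_def sum.distrib sum_subtractf
        sum_distrib_left[symmetric])
qed

section \<open>Moments of Fibonacci triangles\<close>

definition staircase_moment :: "nat \<Rightarrow> nat \<Rightarrow> nat \<Rightarrow> real" where
  "staircase_moment i j N = (\<Sum>x = 1..<N. \<Sum>y = 1..x. real y ^ i * real x ^ j)"

lemma staircase_moment_Suc:
  assumes "N \<ge> 1"
  shows "staircase_moment i j (Suc N) = staircase_moment i j N + power_sum i (Suc N) * real N ^ j"
proof -
  have "power_sum i (Suc N) = (\<Sum>y = 1..N. real y ^ i)"
    unfolding power_sum_def atLeastLessThanSuc_atLeastAtMost ..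
  thus ?thesis using assms by (simp add: staircase_moment_def sum_distrib_right)
qed

lemma staircase_moment_closed_form:
  assumes "N \<ge> 1"
  shows "staircase_moment 0 2 N = (real N^4 - 2 * real N^3 + real N^2) / 4 \<and>
    staircase_moment 1 1 N = (3 * real N^4 - 2 * real N^3 - 3 * real N^2 + 2 * real N) / 24 \<and>
    staircase_moment 2 0 N = (real N^4 - real N^2) / 12 \<and>
    staircase_moment 0 3 N = (6 * real N^5 - 15 * real N^4 + 10 * real N^3 - real N) / 30 \<and>
    staircase_moment 1 2 N = (12 * real N^5 - 15 * real N^4 - 10 * real N^3 + 15 * real N^2 - 2 * real N) / 120 \<and>
    staircase_moment 2 1 N = (8 * real N^5 - 5 * real N^4 - 10 * real N^3 + 5 * real N^2 + 2 * real N) / 120 \<and>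
    staircase_moment 3 0 N = (3 * real N^5 - 5 * real N^3 + 2 * real N) / 60"
  using assms
proof (induction N rule: nat_induct_at_least)
  case base
  show ?case by (simp add: staircase_moment_def)
next
  case (Suc N)
  have "Suc N \<ge> 1" by simp
  note P = power_sum_closed_form[OF this]
  show ?case
    unfolding staircase_moment_Suc[OF Suc.hyps] P
    by (intro conjI; simp only: Suc.IH; simp add: field_simps eval_nat_numeral)
qed

text \<open>Swapping turns the triangle of slope \<open>F\<^bsub>n+1\<^esub> / F\<^bsub>n+2\<^esub>\<close> into one of slope \<open>F\<^bsub>n+2\<^esub> / F\<^bsub>n+1\<^esub>\<close>, which exceeds
\<open>F\<^bsub>n\<^esub> / F\<^bsub>n+1\<^esub>\<close> by exactly one, so a single shear leads back to the preceding Fibonacci triangle.\<close>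
lemma triangle_sum_fib_Suc:
  "triangle_sum (fib (Suc (Suc n))) (fib (Suc n)) p
    = (\<Sum>x = 1..<fib (Suc (Suc n)). \<Sum>y = 1..<fib (Suc n). p x y)
      - (\<Sum>x = 1..<fib (Suc n). \<Sum>y = 1..x. p y x)
      - triangle_sum (fib (Suc n)) (fib n) (\<lambda>x y. p (x + y) x)"
proof -
  have "triangle_sum (fib (Suc n)) (fib (Suc (Suc n))) (\<lambda>x y. p y x)
      = triangle_sum (fib (Suc n)) (fib n) (\<lambda>x y. p (x + y) x)
        + (\<Sum>x = 1..<fib (Suc n). \<Sum>y = 1..x. p y x)"
    using triangle_sum_shear[of "fib (Suc n)" "fib n" "\<lambda>x y. p y x"]
    by (simp add: fib_neq_0_nat add.commute del: One_nat_def)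
  moreover have "coprime (fib (Suc n)) (fib (Suc (Suc n)))" by (rule coprime_fib_Suc_nat)
  ultimately show ?thesis
    using triangle_sum_swap[of "fib (Suc n)" "fib (Suc (Suc n))" p] by (simp add: fib_neq_0_nat del: fib.simps)
qed

definition fib_moment :: "nat \<Rightarrow> nat \<Rightarrow> nat \<Rightarrow> real" where
  "fib_moment n i j = triangle_sum (fib (Suc n)) (fib n) (\<lambda>x y. real x ^ i * real y ^ j)"

text \<open>The substitution \<open>(x, y) \<mapsto> (x + y, x)\<close> preserves the degree of a monomial, so the moments of each
degree satisfy a recursion of their own.\<close>
lemma fib_moment_Suc:
  "fib_moment (Suc n) i j = power_sum i (fib (Suc (Suc n))) * power_sum j (fib (Suc n))
     - staircase_moment i j (fib (Suc n))
     - (\<Sum>k\<le>i. real (i choose k) * fib_moment n (k + j) (i - k))"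
proof -
  have "triangle_sum N M (\<lambda>x y. real (x + y) ^ i * real x ^ j)
      = (\<Sum>k\<le>i. real (i choose k) * triangle_sum N M (\<lambda>x y. real x ^ (k + j) * real y ^ (i - k)))"
    for N M
  proof -
    have "real (x + y) ^ i * real x ^ j
        = (\<Sum>k\<le>i. real (i choose k) * (real x ^ (k + j) * real y ^ (i - k)))" for x y
      by (simp add: binomial_ring sum_distrib_left sum_distrib_right power_add mult_ac)
    thus ?thesis
      unfolding triangle_sum_def sum_distrib_left
      by (simp add: sum.swap[of _ "{..i}"])
  qed
  thus ?thesis
    unfolding fib_moment_def power_sum_def staircase_moment_def triangle_sum_fib_Suc sum_product
    by simp
qed

lemma fib_moment_recurrences:
  shows "fib_moment (Suc n) 0 2 = power_sum 0 (fib (Suc (Suc n))) * power_sum 2 (fib (Suc n))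
      - staircase_moment 0 2 (fib (Suc n)) - fib_moment n 2 0"
    and "fib_moment (Suc n) 1 1 = power_sum 1 (fib (Suc (Suc n))) * power_sum 1 (fib (Suc n))
      - staircase_moment 1 1 (fib (Suc n)) - fib_moment n 1 1 - fib_moment n 2 0"
    and "fib_moment (Suc n) 2 0 = power_sum 2 (fib (Suc (Suc n))) * power_sum 0 (fib (Suc n))
      - staircase_moment 2 0 (fib (Suc n)) - fib_moment n 0 2 - 2 * fib_moment n 1 1 - fib_moment n 2 0"
    and "fib_moment (Suc n) 0 3 = power_sum 0 (fib (Suc (Suc n))) * power_sum 3 (fib (Suc n))
      - staircase_moment 0 3 (fib (Suc n)) - fib_moment n 3 0"
    and "fib_moment (Suc n) 1 2 = power_sum 1 (fib (Suc (Suc n))) * power_sum 2 (fib (Suc n))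
      - staircase_moment 1 2 (fib (Suc n)) - fib_moment n 2 1 - fib_moment n 3 0"
    and "fib_moment (Suc n) 2 1 = power_sum 2 (fib (Suc (Suc n))) * power_sum 1 (fib (Suc n))
      - staircase_moment 2 1 (fib (Suc n)) - fib_moment n 1 2 - 2 * fib_moment n 2 1 - fib_moment n 3 0"
    and "fib_moment (Suc n) 3 0 = power_sum 3 (fib (Suc (Suc n))) * power_sum 0 (fib (Suc n))
      - staircase_moment 3 0 (fib (Suc n)) - fib_moment n 0 3 - 3 * fib_moment n 1 2 - 3 * fib_moment n 2 1 - fib_moment n 3 0"
  unfolding fib_moment_Suc by (simp_all add: numeral_2_eq_2 numeral_3_eq_3)

text \<open>The norm form \<open>v^2 - v * u - u^2\<close> of the golden field takes the values \<open>1\<close> and \<open>-1\<close> at consecutive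
Fibonacci numbers; this is the only property of them that the evaluation below uses apart from
their recursion.\<close>
lemma fib_cassini_real:
  "real (fib (Suc n)) ^ 2 = real (fib (Suc n)) * real (fib n) + real (fib n) ^ 2 + (- 1) ^ n"
  by (induction n) (auto simp: power2_eq_square algebra_simps)

text \<open>These formulas solve the recursions. On the moments of degree 3 the homogeneous recursion is, up to
sign, the symmetric cube of the Fibonacci matrix, whose eigenvalues are the products of three factors
taken from the golden ratio and its conjugate. The mixed products are, up to sign, the golden ratio and
its conjugate themselves. The inhomogeneous part contains multiples of \<open>F\<^bsub>n\<^esub>\<close> and \<open>F\<^bsub>n+1\<^esub>\<close> too, and this
resonance produces the terms that are linear in \<open>n\<close>.\<close>
lemma fib_moment_closed_form:
  assumes "u = real (fib n)" "v = real (fib (Suc n))" "e = (- 1) ^ n"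
  shows "fib_moment n 0 2 = (u^3 * v - 2 * e * u^2 + e * u * v - 2 * u^3 + u^2 - u) / 12 \<and>
      fib_moment n 1 1 = (3 * u^4 + 3 * u^3 * v + 5 * e * u^2 - 2 * e * u * v - 6 * u^2 * v
         + u * v - e + 1) / 24 \<and>
      fib_moment n 2 0 = (3 * u^4 + 6 * u^3 * v + 2 * e * u^2 + 3 * e * u * v - 8 * u^3 - 10
         * u^2 * v - 8 * e * u - 2 * e * v + 4 * u^2 + 6 * u * v + 4 * e - v - 1) / 12 \<and>
      fib_moment n 0 3 = (12 * real n * u + 30 * u^4 * v - 102 * e * u^3 + 54 * e * u^2 * v
         - 75 * u^4 + 50 * u^3 - 75 * u^2 + 10 * u) / 600 \<and>
      fib_moment n 1 2 = (6 * real n * u + 6 * real n * v + 60 * u^5 + 60 * u^4 * v + 141 *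
         e * u^3 - 72 * e * u^2 * v - 150 * u^3 * v + 25 * u^3 + 75 * u^2 * v - 75 * u * v +
         62 * u) / 900 \<and>
      fib_moment n 2 1 = (-6 * real n * u + 6 * real n * v + 90 * u^5 + 180 * u^4 * v + 18 *
         e * u^3 + 99 * e * u^2 * v - 225 * u^4 - 225 * u^3 * v - 225 * e * u^2 + 50 * u^3 +
         100 * u^2 * v + 50 * e * u - 25 * e * v - 78 * u + 25 * v) / 900 \<and>
      fib_moment n 3 0 = (-12 * real n * v + 240 * u^5 + 360 * u^4 * v + 366 * e * u^3 + 198
         * e * u^2 * v - 450 * u^4 - 825 * u^3 * v - 525 * e * u^2 - 450 * e * u * v + 350 *
         u^3 + 550 * u^2 * v + 350 * e * u + 200 * e * v - 75 * u^2 - 75 * u * v - 75 * e +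
         126 * u - 50 * v - 75) / 600"
  using assms
proof (induction n arbitrary: u v e)
  case 0
  thus ?case by (simp add: fib_moment_def triangle_sum_def)
next
  case (Suc n)
  define U V E where "U = real (fib n)" and "V = real (fib (Suc n))" and "E = (- 1 :: real) ^ n"
  note IH = Suc.IH[OF U_def V_def E_def]
  have u: "u = V" and v: "v = U + V" and e: "e = - E"
    using Suc.prems by (simp_all add: U_def V_def E_def)
  have E: "E = V^2 - V * U - U^2"
    unfolding U_def V_def E_def using fib_cassini_real[of n] by simp
  have "E^2 = 1" by (simp add: E_def flip: power_mult)
  hence modulo_norm: "a = b" if "b - a = c * ((V^2 - V * U - U^2)^2 - 1)" for a b c
    using that by (simp add: E)
  have pos: "fib (Suc n) \<ge> 1" "fib (Suc (Suc n)) \<ge> 1"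
    using fib_neq_0_nat[of "Suc n"] fib_neq_0_nat[of "Suc (Suc n)"] by linarith+
  note S1 = staircase_moment_closed_form[OF pos(1), folded V_def]
  note P1 = power_sum_closed_form[OF pos(1), folded V_def]
  have fib2: "real (fib (Suc (Suc n))) = U + V" by (simp add: U_def V_def)
  note P2 = power_sum_closed_form[OF pos(2), unfolded fib2]
  \<comment> \<open>After the sign \<open>E\<close> is replaced by the norm form, both sides are polynomials in \<open>U\<close>, \<open>V\<close>, \<open>n\<close>
    whose difference is a multiple of \<open>norm^2 - 1\<close>. The cofactors below are the quotients obtained
    by division with respect to \<open>V\<close>.\<close>
  show ?case
    unfolding u v e fib_moment_recurrences P1 P2 
    apply (simp only: S1 IH of_nat_Suc E)
    apply (intro conjI)
    subgoal by (rule modulo_norm[of _ _ "1/12"]) (simp add: field_simps eval_nat_numeral)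
    subgoal by (rule modulo_norm[of _ _ "0"]) (simp add: field_simps eval_nat_numeral)
    subgoal by (rule modulo_norm[of _ _ "1/12"]) (simp add: field_simps eval_nat_numeral)
    subgoal by (rule modulo_norm[of _ _ "2/25*V + 1/8 - 21/100*U"]) (simp add: field_simps eval_nat_numeral)
    subgoal by (rule modulo_norm[of _ _ "1/8 - V/100 - 13/100*U"]) (simp add: field_simps eval_nat_numeral)
    subgoal by (rule modulo_norm[of _ _ "7/100*V+1/8-7/50*U"]) (simp add: field_simps eval_nat_numeral)
    subgoal by (rule modulo_norm[of _ _ "1/4-7/50*V-7/100*U"]) (simp add: field_simps eval_nat_numeral)
    done
qed

section \<open>Evaluation of the trigonometric sum\<close>

lemma fib_lucas_double_Suc:
  "fib (2 * Suc n) = fib (Suc n) * (fib (Suc n) + 2 * fib n)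
   \<and> lucas (2 * Suc n) = 3 * fib (Suc n) ^ 2 + 2 * fib n ^ 2 + 2 * fib n * fib (Suc n)"
proof -
  have odd_even: "fib (2 * k + 1) = fib k ^ 2 + fib (Suc k) ^ 2
      \<and> fib (2 * k + 2) = fib (Suc k) * (fib (Suc k) + 2 * fib k)" for k
    by (induction k) (auto simp: power2_eq_square algebra_simps)
  have "lucas (Suc k) = fib k + fib (Suc (Suc k))" for k
    by (induction k rule: fib.induct) auto
  from this[of "2 * n + 1"] have "lucas (2 * Suc n) = fib (2 * n + 1) + fib (2 * Suc n + 1)"
    by simp
  thus ?thesis
    using odd_even[of n] odd_even[of "Suc n"] by (simp add: power2_eq_square algebra_simps)
qed

text \<open>The polynomial produced by the remainders has degree 3 and 2 components only, so that the moments
computed above suffice.\<close>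
lemma sum_fib_remainder_products:
  fixes n :: nat
  defines "u \<equiv> real (fib n)" and "v \<equiv> real (fib (Suc n))"
  shows "(\<Sum>l<fib (Suc n). real l * (v - real l)
            * (real (fib n * l mod fib (Suc n)) * (v - real (fib n * l mod fib (Suc n)))))
    = u * (v ^ 2 * power_sum 2 (fib (Suc n)) - v * (1 + u) * power_sum 3 (fib (Suc n))
        + u * power_sum 4 (fib (Suc n)))
      + 2 * v * (u * v * fib_moment n 2 0 - u * fib_moment n 3 0
        - v ^ 2 * fib_moment n 1 1 + v * fib_moment n 2 1)"
proof -
  have "triangle_sum (fib (Suc n)) (fib n) (\<lambda>x y. real x * (v - real x) * (u * real x - v * real y))
      = triangle_sum (fib (Suc n)) (fib n) (\<lambda>x y. u * v * (real x ^ 2 * real y ^ 0)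
          - u * (real x ^ 3 * real y ^ 0) - v ^ 2 * (real x ^ 1 * real y ^ 1)
          + v * (real x ^ 2 * real y ^ 1))"
    by (rule arg_cong[where f = "triangle_sum _ _"], intro ext)
       (simp add: algebra_simps power2_eq_square power3_eq_cube)
  also have "\<dots> = u * v * fib_moment n 2 0 - u * fib_moment n 3 0
        - v ^ 2 * fib_moment n 1 1 + v * fib_moment n 2 1"
    unfolding fib_moment_def triangle_sum_def
    by (simp only: sum.distrib sum_subtractf sum_distrib_left[symmetric])
  finally show ?thesis
    using sum_remainder_products[of "fib (Suc n)" "fib n"]
    by (simp add: u_def v_def fib_neq_0_nat del: fib.simps)
qed

theorem theorem4p1:
  fixes n :: nat
  assumes "n \<ge> 2"
  shows "(\<Sum>m = 1..fib n - 1.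
            1 / (sin (pi * real m / real (fib n)))\<^sup>2
          * (1 / (sin (pi * real (fib (n - 1)) * real m / real (fib n)))\<^sup>2))
       = 4 * real n / 75 * real (fib (2 * n)) - 17 / 1125 * real (lucas (2 * n))
         - (- 1) ^ n * (116 / 1125) - 1 / 9"
proof -
  obtain k where n: "n = Suc k" using assms by (cases n) auto
  define u v e where "u = real (fib k)" and "v = real (fib (Suc k))" and "e = (- 1 :: real) ^ k"
  have pos: "fib (Suc k) > 0" and v: "v > 0"
    by (simp_all add: v_def fib_neq_0_nat)
  hence ge1: "fib (Suc k) \<ge> 1" by simp
  have e: "e = v^2 - v * u - u^2"
    unfolding u_def v_def e_def using fib_cassini_real[of k] by simp
  have "e^2 = 1" by (simp add: e_def flip: power_mult)
  hence modulo_norm: "a = b" if "a - b = c * ((v^2 - v * u - u^2)^2 - 1)" for a b c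
    using that by (simp add: e)
  note P = power_sum_closed_form[OF ge1, folded v_def]
  note M = fib_moment_closed_form[OF u_def v_def e_def]
  define R where "R = (v - 1) * (2 * v - 1)"
  define Q where "Q = (\<Sum>l<fib (Suc k). real l * (v - real l)
            * (real (fib k * l mod fib (Suc k)) * (v - real (fib k * l mod fib (Suc k)))))"
  have sum_bounds: "{1..fib n - 1} = {1..<fib (Suc k)}" using pos unfolding n by auto
  have "(\<Sum>m = 1..fib n - 1.
            1 / (sin (pi * real m / real (fib n)))\<^sup>2
          * (1 / (sin (pi * real (fib (n - 1)) * real m / real (fib n)))\<^sup>2))
      = 4 / v * Q - (v^2 - 1)^2 / 9"
    using sum_reciprocal_sine_squares[OF coprime_fib_Suc_nat pos]
    unfolding sum_bounds by (simp add: n v_def Q_def del: fib.simps)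
  also have "4 / v * Q = 4 * u * (v^2 * R / 6 - (1 + u) * (v * (v - 1))^2 / 4
          + u * R * (3 * v^2 - 3 * v - 1) / 30)
        + 8 * (u * v * fib_moment k 2 0 - u * fib_moment k 3 0
          - v ^ 2 * fib_moment k 1 1 + v * fib_moment k 2 1)"
  proof -
    have "Q = v * (u * (v^2 * R / 6 - (1 + u) * (v * (v - 1))^2 / 4
          + u * R * (3 * v^2 - 3 * v - 1) / 30)
        + 2 * (u * v * fib_moment k 2 0 - u * fib_moment k 3 0
          - v ^ 2 * fib_moment k 1 1 + v * fib_moment k 2 1))"
      unfolding Q_def sum_fib_remainder_products[of k, folded u_def v_def] P R_def
      by (simp add: algebra_simps power2_eq_square)
    moreover have "4 / v * (v * (u * a + 2 * b)) = 4 * u * a + 8 * b" for a b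
      using v by (simp add: field_simps)
    ultimately show ?thesis by (simp only:)
  qed
  also have "\<dots> - (v^2 - 1)^2 / 9 = 4 * (real k + 1) / 75 * (v * (v + 2 * u))
      - 17 / 1125 * (3 * v^2 + 2 * u^2 + 2 * u * v) + (v^2 - v * u - u^2) * (116 / 1125) - 1 / 9"
    unfolding R_def
    \<comment> \<open>As before, the cofactor is the quotient of a polynomial division with respect to \<open>v\<close>.\<close>
    by (rule modulo_norm[of _ _ "2 / 3 * u * v - u + 42 / 25 * u^2"])
       (simp only: M e, simp add: field_simps eval_nat_numeral)
  also have "\<dots> = 4 * real n / 75 * real (fib (2 * n)) - 17 / 1125 * real (lucas (2 * n))
         - (- 1) ^ n * (116 / 1125) - 1 / 9"
  proof -
    have "real (fib (2 * n)) = v * (v + 2 * u)"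
      using fib_lucas_double_Suc[of k] by (simp add: n u_def v_def)
    moreover have "real (lucas (2 * n)) = 3 * v^2 + 2 * u^2 + 2 * u * v"
      using fib_lucas_double_Suc[of k] by (simp add: n u_def v_def)
    moreover have "(- 1) ^ n = - (v^2 - v * u - u^2)"
      using e by (simp add: n e_def)
    moreover have "real n = real k + 1" by (simp add: n)
    ultimately show ?thesis by (simp only: mult_minus_left diff_minus_eq_add)
  qed
  finally show ?thesis .
qed

end
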